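(* Let $(Z_\alpha)$ and $(\epsilon_\alpha)$ be nets of normal integrands and non-negative (real) random variables, respectively, with $Z_\alpha,\epsilon_\alpha$ defined on a probability space $(\Omega_\alpha,\mathcal{A}_\alpha,\mathbb{P}_\alpha)$, and let $Z$ be a normal integrand and $\epsilon$ a non-negative (real) random variable on a probability space $(\Omega,\mathcal{A},\mathbb{P})$. For each $\alpha$ let $\xi_\alpha:\Omega_\alpha\to E$ be a measurable selection of $A(Z_\alpha,\epsilon_\alpha)$. Assume that $$(Z_\alpha,\epsilon_\alpha)\stackrel{\mathcal{D}}{\rightarrow}(Z,\epsilon)\quad\text{in }(S\times\mathbb{R}_+,\tau_e\times\mathcal{T})$$ and that for every $\eta>0$ there exists a compact $K\subseteq E$ with $$\liminf_\alpha\mathbb{P}_\alpha(\{\omega\in\Omega_\alpha:\xi_\alpha(\omega)\in K\})\ge1-\eta.$$ Then $$\limsup_\alpha\mathbb{P}_\alpha(\{\omega\in\Omega_\alpha:\xi_\alpha(\omega)\in F\})\le T(F)\quad\text{for all closed sets }F\text{ in }E,$$ where $T:\mathcal{B}(E)\to[0,1]$ is the capacity functional of $A(Z,\epsilon)$, i.e. $T(B)=\mathbb{P}(A(Z,\epsilon)\cap B\neq\emptyset)$ for all Borel sets $B\in\mathcal{B}(E)$. If $\epsilon=0$ and $\mathrm{Argmin}(Z)\subseteq\{\xi\}$ $\mathbb{P}$-almost surely for some random variable $\xi$ on $(\Omega,\mathcal{A},\mathbb{P})$ with values in $E$, then $$\xi_\alpha\stackrel{\mathcal{D}}{\rightarrow}\xi\quad\text{in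 }(E,\mathcal{G}).$$
   Context: $(E,\mathcal{G})$ is a locally compact second countable Hausdorff space with Borel $\sigma$-algebra $\mathcal{B}(E)$, and $\mathcal{K}$ is the family of its compact subsets. $S$ is the set of all lower semicontinuous $f:E\to[-\infty,\infty]$; $I_A(f)=\inf_{x\in A}f(x)$ for $A\subseteq E$. The epi-topology $\tau_e$ is the coarsest topology on $S$ for which $I_K$ is lower semicontinuous for all $K\in\mathcal{K}$ and $I_G$ is upper semicontinuous for all $G\in\mathcal{G}$; $\mathcal{B}_e=\sigma(\tau_e)$. A normal integrand on a measurable space $(\Omega,\mathcal{A})$ is an $\mathcal{A}$–$\mathcal{B}_e$ measurable map $Z:\Omega\to S$. $\mathbb{R}_+=[0,\infty)$ and $\mathcal{T}=\{[0,r):0<r\in\mathbb{R}\}\cup\{\emptyset,\mathbb{R}_+\}$ is the left-order topology on $\mathbb{R}_+$; $\tau_e\times\mathcal{T}$ is the product topology. For $f\in S$, $\epsilon\ge0$: $A(f,\epsilon)=\{t\in E:f(t)\le I_E(f)+\epsilon\}$ (a closed set), and $\mathrm{Argmin}(f)=A(f,0)$. A measurable selection of $A(Z_\alpha,\epsilon_\alpha)$ is an $\mathcal{A}_\alpha$–$\mathcal{B}(E)$ measurable map $\xi_\alpha:\Omega_\alpha\to E$ with $\xi_\alpha\in A(Z_\alpha,\epsilon_\alpha)$ $\mathbb{P}_\alpha$-almost surely. Convergence in distribution $X_\alpha\stackrel{\mathcal{D}}{\rightarrow}X$ in a topological space $(\mathcal{X},\mathcal{O})$ of a net of random elements (measurable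 with respect to $\sigma(\mathcal{O})$, possibly defined on different probability spaces) means $\liminf_\alpha\mathbb{P}_\alpha(X_\alpha\in O)\ge\mathbb{P}(X\in O)$ for all $O\in\mathcal{O}$. *)

theory Defs
  imports "HOL-Probability.Probability"
begin

text \<open>The space \<open>E\<close> is the universe of a type \<open>'a\<close>, and \<open>\<B>(E)\<close> is \<open>borel\<close>.\<close>

subsection \<open>Semicontinuity and the epi-topology\<close>

definition lower_semicont :: "'x topology \<Rightarrow> ('x \<Rightarrow> ereal) \<Rightarrow> bool" where
  "lower_semicont X h \<longleftrightarrow> (\<forall>c. openin X {x \<in> topspace X. c < h x})"

definition upper_semicont :: "'x topology \<Rightarrow> ('x \<Rightarrow> ereal) \<Rightarrow> bool" where
  "upper_semicont X h \<longleftrightarrow> (\<forall>c. openin X {x \<in> topspace X. h x < c})"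

definition lsc_functions :: "('a::topological_space \<Rightarrow> ereal) set" where
  "lsc_functions = {f. lower_semicont euclidean f}"

text \<open>Infima are taken in \<open>ereal\<close>, so \<open>inf_on {} f = \<infinity>\<close>.\<close>

definition inf_on :: "'a set \<Rightarrow> ('a \<Rightarrow> ereal) \<Rightarrow> ereal" where
  "inf_on A f = (INF x\<in>A. f x)"

definition epi_topology :: "('a::topological_space \<Rightarrow> ereal) topology" where
  "epi_topology = topology_generated_by
     ({{f \<in> lsc_functions. c < inf_on K f} | K c. compact K} \<union>
      {{f \<in> lsc_functions. inf_on G f < c} | G c. open G})"

lemma topspace_epi_topology [simp]: "topspace epi_topology = lsc_functions"
proof -
  have "lsc_functions = {f \<in> lsc_functions. 0 < inf_on {} f}"
    by (simp add: inf_on_def top_ereal_def)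
  then have "lsc_functions \<in> {{f \<in> lsc_functions. c < inf_on K f} | K c. compact K}"
    by (intro CollectI exI[of _ "{}"] exI[of _ 0] conjI compact_empty)
  then show ?thesis
    unfolding epi_topology_def topology_generated_by_topspace by fast
qed

lemma lower_semicont_inf_on_epi_topology:
  "compact K \<Longrightarrow> lower_semicont epi_topology (inf_on K)"
  unfolding lower_semicont_def
proof
  fix c
  assume "compact K"
  then show "openin epi_topology {f \<in> topspace epi_topology. c < inf_on K f}"
    unfolding topspace_epi_topology
    unfolding epi_topology_def
    by (intro topology_generated_by_Basis UnI1 CollectI exI[of _ K] exI[of _ c] conjI refl)
qed

lemma upper_semicont_inf_on_epi_topology:
  "open G \<Longrightarrow> upper_semicont epi_topology (inf_on G)"
  unfolding upper_semicont_def
proof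
  fix c
  assume "open G"
  then show "openin epi_topology {f \<in> topspace epi_topology. inf_on G f < c}"
    unfolding topspace_epi_topology
    unfolding epi_topology_def
    by (intro topology_generated_by_Basis UnI2 CollectI exI[of _ G] exI[of _ c] conjI refl)
qed

lemma epi_topology_coarsest:
  assumes top: "topspace X = lsc_functions"
    and lower: "\<And>K. compact K \<Longrightarrow> lower_semicont X (inf_on K)"
    and upper: "\<And>G. open G \<Longrightarrow> upper_semicont X (inf_on G)"
    and U: "openin epi_topology U"
  shows "openin X U"
proof -
  let ?B = "{{f \<in> lsc_functions. c < inf_on K f} | K c. compact K} \<union>
      {{f \<in> lsc_functions. inf_on G f < c} | G c. open G}"
  have "generate_topology_on ?B U"
    using U by (simp add: epi_topology_def openin_topology_generated_by_iff)
  then show ?thesis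
  proof induction
    case (Basis s)
    then consider K c where "compact K" "s = {f \<in> lsc_functions. c < inf_on K f}"
      | G c where "open G" "s = {f \<in> lsc_functions. inf_on G f < c}"
      by fast
    then show ?case
    proof cases
      case 1
      then show ?thesis using lower[OF 1(1)] unfolding lower_semicont_def top by simp
    next
      case 2
      then show ?thesis using upper[OF 2(1)] unfolding upper_semicont_def top by simp
    qed
  next
    case (UN \<U>)
    then show ?case by (intro openin_Union)
  qed (simp_all add: openin_Int)
qed

subsection \<open>The left-order topology on \<open>[0, \<infinity>)\<close>\<close>

definition left_order_topology :: "real topology" where
  "left_order_topology = topology (\<lambda>U. U = {} \<or> U = {0..} \<or> (\<exists>r>0. U = {0..<r}))"

lemma openin_left_order_topology:
  "openin left_order_topology U \<longleftrightarrow> U = {} \<or> U = {0..} \<or> (\<exists>r>0. U = {0..<r})"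
proof -
  let ?P = "\<lambda>U::real set. U = {} \<or> U = {0..} \<or> (\<exists>r>0. U = {0..<r})"
  have "istopology ?P"
    unfolding istopology_def
  proof (intro conjI allI impI)
    fix S T assume S: "?P S" and T: "?P T"
    show "?P (S \<inter> T)"
    proof (cases "(\<exists>r>0. S = {0..<r}) \<and> (\<exists>r>0. T = {0..<r})")
      case True
      then obtain r s where "0 < r" "0 < s" "S = {0..<r}" "T = {0..<s}" by blast
      then have "0 < min r s \<and> S \<inter> T = {0..<min r s}" by auto
      then show ?thesis by blast
    next
      case False
      then have "S = {} \<or> S = {0..} \<or> T = {} \<or> T = {0..}" using S T by blast
      moreover have "S \<subseteq> {0..}" "T \<subseteq> {0..}" using S T by auto
      ultimately have "S \<inter> T = {} \<or> S \<inter> T = T \<or> S \<inter> T = S" by blast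
      then show ?thesis
      proof (elim disjE)
        assume "S \<inter> T = {}"
        then show ?thesis by (rule disjI1)
      next
        assume eq: "S \<inter> T = T"
        show ?thesis unfolding eq by (rule T)
      next
        assume eq: "S \<inter> T = S"
        show ?thesis unfolding eq by (rule S)
      qed
    qed
  next
    fix \<K> assume K: "\<forall>K\<in>\<K>. ?P K"
    define R where "R = {r. 0 < r \<and> {0..<r} \<in> \<K>}"
    have cases: "k = {} \<or> k = {0..} \<or> (\<exists>r\<in>R. k = {0..<r})" if "k \<in> \<K>" for k
      using bspec[OF K that] that unfolding R_def by blast
    have RI: "x \<in> \<Union>\<K>" if "r \<in> R" "0 \<le> x" "x < r" for r x
    proof (rule UnionI)
      show "{0..<r} \<in> \<K>" using that(1) by (simp add: R_def)
      show "x \<in> {0..<r}" using that by simp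
    qed
    have sub: "0 \<le> x" if x: "x \<in> \<Union>\<K>" for x
    proof -
      obtain k where k: "k \<in> \<K>" "x \<in> k" using x by (rule UnionE)
      from cases[OF k(1)] k(2) show ?thesis by (elim disjE bexE) simp_all
    qed
    show "?P (\<Union>\<K>)"
    proof (cases "{0..} \<in> \<K>")
      case True
      have "\<Union>\<K> = {0..}"
      proof (rule subset_antisym; rule subsetI)
        fix x assume "x \<in> \<Union>\<K>"
        then show "x \<in> {0..}" using sub by simp
      qed (rule UnionI[OF True])
      then show ?thesis by (intro disjI2 disjI1)
    next
      case notall: False
      have cases': "\<exists>r\<in>R. x < r" if x: "x \<in> \<Union>\<K>" for x
      proof -
        obtain k where k: "k \<in> \<K>" "x \<in> k" using x by (rule UnionE)
        have "k \<noteq> {}" "k \<noteq> {0..}" using k notall by fast+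
        then obtain r where "r \<in> R" "k = {0..<r}" using cases[OF k(1)] by fast
        then show ?thesis using k(2) by (intro bexI[of _ r]) simp_all
      qed
      show ?thesis
      proof (cases "bdd_above R")
        case unbdd: False
        have "\<Union>\<K> = {0..}"
        proof (rule subset_antisym; rule subsetI)
          fix x assume "x \<in> \<Union>\<K>"
          then show "x \<in> {0..}" using sub by simp
        next
          fix x :: real assume x: "x \<in> {0..}"
          obtain r where "r \<in> R" "x < r"
            using unbdd unfolding bdd_above_def by (meson not_le)
          then show "x \<in> \<Union>\<K>" using RI x by simp
        qed
        then show ?thesis by (intro disjI2 disjI1)
      next
        case bdd: True
        show ?thesis
        proof (cases "R = {}")
          case True
          then have "\<Union>\<K> = {}" using cases' by fast
          then show ?thesis by (rule disjI1)
        next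
          case ne: False
          then obtain r0 where r0: "r0 \<in> R" by fast
          have "0 < r0" using r0 by (simp add: R_def)
          also have "r0 \<le> Sup R" by (rule cSup_upper[OF r0 bdd])
          finally have pos: "0 < Sup R" .
          have "\<Union>\<K> = {0..<Sup R}"
          proof (rule subset_antisym; rule subsetI)
            fix x assume x: "x \<in> \<Union>\<K>"
            obtain r where r: "r \<in> R" "x < r" using cases'[OF x] by (rule bexE)
            from cSup_upper[OF r(1) bdd] r(2) sub[OF x] show "x \<in> {0..<Sup R}" by simp
          next
            fix x assume x: "x \<in> {0..<Sup R}"
            then have "x < Sup R" by simp
            then obtain r where "r \<in> R" "x < r"
              unfolding less_cSup_iff[OF ne bdd] by (rule bexE)
            then show "x \<in> \<Union>\<K>" using RI x by simp
          qed
          then show ?thesis using pos by (intro disjI2 exI[of _ "Sup R"] conjI)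
        qed
      qed
    qed
  qed
  then show ?thesis
    unfolding left_order_topology_def by (simp add: topology_inverse')
qed

lemma topspace_left_order_topology [simp]: "topspace left_order_topology = {0..}"
proof
  show "topspace left_order_topology \<subseteq> {0..}"
  proof
    fix x assume "x \<in> topspace left_order_topology"
    then obtain U where "openin left_order_topology U" "x \<in> U"
      using openin_topspace by blast
    then show "x \<in> {0..}" by (auto simp: openin_left_order_topology)
  qed
  show "{0..} \<subseteq> topspace left_order_topology"
    by (rule openin_subset) (simp add: openin_left_order_topology)
qed

subsection \<open>Random elements of topological spaces\<close>

definition borel_of :: "'x topology \<Rightarrow> 'x measure" where
  "borel_of X = sigma (topspace X) {U. openin X U}"

lemma sets_borel_of_euclidean: "sets (borel_of euclidean) = sets borel"
  by (simp add: borel_of_def borel_def)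

definition normal_integrand ::
  "'w measure \<Rightarrow> ('w \<Rightarrow> 'a::topological_space \<Rightarrow> ereal) \<Rightarrow> bool" where
  "normal_integrand M Z \<longleftrightarrow> Z \<in> M \<rightarrow>\<^sub>M borel_of epi_topology"

subsection \<open>Nets and convergence in distribution\<close>

definition directed_preorder :: "'i set \<Rightarrow> ('i \<Rightarrow> 'i \<Rightarrow> bool) \<Rightarrow> bool" where
  "directed_preorder I le \<longleftrightarrow> I \<noteq> {} \<and> reflp_on I le \<and> transp_on I le \<and>
     (\<forall>a\<in>I. \<forall>b\<in>I. \<exists>c\<in>I. le a c \<and> le b c)"

text \<open>The filter of tails of the directed set; \<open>Liminf\<close> and \<open>Limsup\<close> along it are the
  limes inferior and limes superior of nets indexed by the directed set.\<close>

definition tails :: "'i set \<Rightarrow> ('i \<Rightarrow> 'i \<Rightarrow> bool) \<Rightarrow> 'i filter" where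
  "tails I le = (INF a\<in>I. principal {b \<in> I. le a b})"

lemma eventually_tails:
  assumes "directed_preorder I le"
  shows "eventually P (tails I le) \<longleftrightarrow> (\<exists>a\<in>I. \<forall>b\<in>I. le a b \<longrightarrow> P b)"
proof -
  have "eventually P (tails I le) \<longleftrightarrow> (\<exists>a\<in>I. eventually P (principal {b \<in> I. le a b}))"
    unfolding tails_def
  proof (rule eventually_INF_base)
    show "I \<noteq> {}" using assms by (simp add: directed_preorder_def)
  next
    fix a b assume ab: "a \<in> I" "b \<in> I"
    then obtain c where c: "c \<in> I" "le a c" "le b c"
      using assms by (auto simp: directed_preorder_def)
    have "transp_on I le" using assms by (simp add: directed_preorder_def)
    then have "{d \<in> I. le c d} \<subseteq> {d \<in> I. le a d} \<inter> {d \<in> I. le b d}"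
      using ab c by (auto dest: transp_onD)
    with c show "\<exists>x\<in>I. principal {d \<in> I. le x d}
        \<le> inf (principal {d \<in> I. le a d}) (principal {d \<in> I. le b d})"
      by auto
  qed
  then show ?thesis by (auto simp: eventually_principal)
qed

definition conv_in_distr ::
  "'x topology \<Rightarrow> 'i set \<Rightarrow> ('i \<Rightarrow> 'i \<Rightarrow> bool) \<Rightarrow> ('i \<Rightarrow> 'w measure) \<Rightarrow> ('i \<Rightarrow> 'w \<Rightarrow> 'x) \<Rightarrow>
    'v measure \<Rightarrow> ('v \<Rightarrow> 'x) \<Rightarrow> bool" where
  "conv_in_distr \<X> I le M X N Y \<longleftrightarrow>
     (\<forall>\<alpha>\<in>I. X \<alpha> \<in> M \<alpha> \<rightarrow>\<^sub>M borel_of \<X>) \<and> Y \<in> N \<rightarrow>\<^sub>M borel_of \<X> \<and>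
     (\<forall>U. openin \<X> U \<longrightarrow>
        ereal \<P>(\<omega> in N. Y \<omega> \<in> U) \<le> Liminf (tails I le) (\<lambda>\<alpha>. ereal \<P>(\<omega> in M \<alpha>. X \<alpha> \<omega> \<in> U)))"

subsection \<open>Approximate minimizers\<close>

definition approx_argmin :: "('a \<Rightarrow> ereal) \<Rightarrow> real \<Rightarrow> 'a set" where
  "approx_argmin f e = {t. f t \<le> inf_on UNIV f + ereal e}"

definition Argmin :: "('a \<Rightarrow> ereal) \<Rightarrow> 'a set" where
  "Argmin f = approx_argmin f 0"

definition measurable_selection ::
  "'w measure \<Rightarrow> ('w \<Rightarrow> 'a::topological_space set) \<Rightarrow> ('w \<Rightarrow> 'a) \<Rightarrow> bool" where
  "measurable_selection M C \<xi> \<longleftrightarrow> \<xi> \<in> M \<rightarrow>\<^sub>M borel \<and> (AE \<omega> in M. \<xi> \<omega> \<in> C \<omega>)"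

text \<open>For a random closed set \<open>C\<close> the event below belongs to \<open>sets M\<close> whenever \<open>B\<close> is closed;
  for a general Borel set \<open>B\<close> it need only belong to \<open>sets (completion M)\<close>.\<close>

definition capacity_functional ::
  "'w measure \<Rightarrow> ('w \<Rightarrow> 'a::topological_space set) \<Rightarrow> 'a set \<Rightarrow> real" where
  "capacity_functional M C B = \<P>(\<omega> in completion M. C \<omega> \<inter> B \<noteq> {})"

end

theory Submission
  imports Defs
begin

text \<open>
  The one topological fact behind the theorem is that, for a compact set \<open>K\<close>, the pairs
  \<open>(f, e)\<close> with \<open>A(f, e) \<inter> K = {}\<close> form an open set. Since \<open>f\<close> attains its
  infimum on \<open>K\<close>, avoiding \<open>K\<close> means \<open>I\<^sub>E(f) + e < I\<^sub>K(f)\<close>, and a real number strictly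
  between the two sides splits this inequality into a lower bound on \<open>I\<^sub>K(f)\<close>, an upper bound
  on \<open>I\<^sub>E(f)\<close> and an upper bound on \<open>e\<close>. These are exactly the kinds of conditions that
  generate the epi-topology and the left-order topology
  (lemma \<open>openin_approx_argmin_avoiding\<close>).

  When \<open>\<xi>\<^sub>\<alpha>\<close> lies in \<open>K\<close>, the random set \<open>A(Z\<^sub>\<alpha>, \<epsilon>\<^sub>\<alpha>)\<close> almost surely meets \<open>K\<close>, so
  convergence in distribution of the pairs bounds the limes superior of the probabilities of
  \<open>\<xi>\<^sub>\<alpha> \<in> K\<close> by \<open>T(K)\<close> (lemma \<open>Limsup_prob_selection_in_compact\<close>). Asymptotic tightness
  extends this from compact to closed sets: for closed \<open>F\<close>, all but an arbitrarily small part
  of the mass of \<open>\<xi>\<^sub>\<alpha>\<close> in \<open>F\<close> lies in a compact \<open>F \<inter> K\<close>, where \<open>T(F \<inter> K) \<le> T(F)\<close>.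
  The inequality \<open>T(F \<inter> K) \<le> T(F)\<close> is monotonicity of the measure, provided that meeting
  \<open>F\<close> is a measurable event; that is a consequence of \<open>\<sigma>\<close>-compactness of the space.

  If \<open>\<epsilon> = 0\<close> and \<open>\<xi>\<close> is the only possible minimizer of \<open>Z\<close>, then \<open>T(F)\<close> is at most the
  probability of \<open>\<xi> \<in> F\<close>, and passing to complements gives convergence in distribution.
\<close>

section \<open>Infima of lower semicontinuous functions on compact sets\<close>

text \<open>
  This replaces attainment of the infimum. A value of \<open>f\<close> above \<open>c\<close> also exceeds some \<open>b > c\<close>,
  so the open sets \<open>{b < f}\<close> with \<open>b > c\<close> cover \<open>K\<close>; the smallest \<open>b\<close> of a finite subcover
  separates \<open>c\<close> from the infimum. For empty \<open>K\<close> and \<open>c = \<infinity>\<close> the equivalence fails.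
\<close>

lemma less_inf_on_compact_iff:
  assumes f: "lower_semicont euclidean f" and K: "compact K" "K \<noteq> {}"
  shows "c < inf_on K f \<longleftrightarrow> (\<forall>t\<in>K. c < f t)"
proof
  assume "c < inf_on K f"
  then show "\<forall>t\<in>K. c < f t"
    unfolding inf_on_def by (meson INF_lower less_le_trans)
next
  assume above: "\<forall>t\<in>K. c < f t"
  have "open {t. b < f t}" for b
    using f by (simp add: lower_semicont_def)
  moreover have "K \<subseteq> (\<Union>b\<in>{c<..}. {t. b < f t})"
    using above dense by fastforce
  ultimately obtain B where B: "B \<subseteq> {c<..}" "finite B" "K \<subseteq> (\<Union>b\<in>B. {t. b < f t})"
    using compactE_image[OF K(1), of "{c<..}" "\<lambda>b. {t. b < f t}"] by blast
  have "B \<noteq> {}" using B(3) K(2) by blast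
  then have "c < Min B" using B(1,2) by (simp add: subset_iff)
  also have "Min B \<le> inf_on K f"
    unfolding inf_on_def
  proof (rule INF_greatest)
    fix t assume "t \<in> K"
    then obtain b where "b \<in> B" "b < f t" using B(3) by blast
    then show "Min B \<le> f t" using Min_le[OF B(2), of b] by simp
  qed
  finally show "c < inf_on K f" .
qed

lemma approx_argmin_disjoint_iff:
  assumes "lower_semicont euclidean f" "compact K" "K \<noteq> {}"
  shows "approx_argmin f e \<inter> K = {} \<longleftrightarrow> inf_on UNIV f + ereal e < inf_on K f"
  unfolding less_inf_on_compact_iff[OF assms] approx_argmin_def by (auto simp: disjoint_iff not_le)

section \<open>Pairs whose approximate minimizers avoid a compact set\<close>

definition approx_argmin_avoiding ::
  "'a::topological_space set \<Rightarrow> (('a \<Rightarrow> ereal) \<times> real) set" where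
  "approx_argmin_avoiding K =
     {(f, e). f \<in> lsc_functions \<and> 0 \<le> e \<and> approx_argmin f e \<inter> K = {}}"

text \<open>
  The boxes below witness openness: if \<open>I\<^sub>E(f) + e < c < I\<^sub>K(f)\<close>, then some \<open>r > e\<close> still has
  \<open>I\<^sub>E(f) < c - r\<close>, and \<open>I\<^sub>E(g) < c - r\<close>, \<open>e' < r\<close>, \<open>c < I\<^sub>K(g)\<close> together give
  \<open>I\<^sub>E(g) + e' < I\<^sub>K(g)\<close>.
\<close>

lemma openin_approx_argmin_avoiding:
  fixes K :: "'a::topological_space set"
  assumes "compact K"
  shows "openin (prod_topology epi_topology left_order_topology) (approx_argmin_avoiding K)"
proof (cases "K = {}")
  case True
  then have "approx_argmin_avoiding K =
      topspace (prod_topology epi_topology left_order_topology)"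
    by (auto simp: approx_argmin_avoiding_def)
  then show ?thesis by (metis openin_topspace)
next
  case False
  define box :: "real \<Rightarrow> real \<Rightarrow> (('a \<Rightarrow> ereal) \<times> real) set" where
    "box c r = ({f \<in> lsc_functions. ereal c < inf_on K f}
       \<inter> {f \<in> lsc_functions. inf_on UNIV f < ereal (c - r)}) \<times> {0..<r}" for c r
  have iff: "approx_argmin f e \<inter> K = {} \<longleftrightarrow> inf_on UNIV f + ereal e < inf_on K f"
    if "f \<in> lsc_functions" for f e
    using that assms False by (intro approx_argmin_disjoint_iff) (auto simp: lsc_functions_def)
  have "openin (prod_topology epi_topology left_order_topology) (box c r)" if "0 < r" for c r
    unfolding box_def
  proof (intro openin_prod_Times_iff[THEN iffD2] disjI2 conjI openin_Int)
    show "openin epi_topology {f \<in> lsc_functions. ereal c < inf_on K f}"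
      using lower_semicont_inf_on_epi_topology[OF assms]
      unfolding lower_semicont_def topspace_epi_topology by blast
    show "openin epi_topology {f \<in> lsc_functions. inf_on UNIV f < ereal (c - r)}"
      using upper_semicont_inf_on_epi_topology[OF open_UNIV]
      unfolding upper_semicont_def topspace_epi_topology by blast
    show "openin left_order_topology {0..<r}"
      using that by (auto simp: openin_left_order_topology)
  qed
  then have "openin (prod_topology epi_topology left_order_topology) (\<Union>c. \<Union>r\<in>{0<..}. box c r)"
    by (intro openin_Union) auto
  also have "(\<Union>c. \<Union>r\<in>{0<..}. box c r) = approx_argmin_avoiding K"
  proof (intro subset_antisym subsetI)
    fix p assume "p \<in> (\<Union>c. \<Union>r\<in>{0<..}. box c r)"
    then obtain g e c r where p: "p = (g, e)" "g \<in> lsc_functions" "0 \<le> e" "e < r"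
        "ereal c < inf_on K g" "inf_on UNIV g < ereal (c - r)"
      by (auto simp: box_def)
    have "inf_on UNIV g + ereal e < ereal c"
      using p(4,6) by (cases "inf_on UNIV g") auto
    also note p(5)
    finally show "p \<in> approx_argmin_avoiding K"
      using p(1-3) iff by (simp add: approx_argmin_avoiding_def)
  next
    fix p assume "p \<in> approx_argmin_avoiding K"
    then obtain f e where p: "p = (f, e)" "f \<in> lsc_functions" "0 \<le> e"
        "inf_on UNIV f + ereal e < inf_on K f"
      using iff by (auto simp: approx_argmin_avoiding_def)
    obtain c where c: "inf_on UNIV f + ereal e < ereal c" "ereal c < inf_on K f"
      using ereal_dense2[OF p(4)] by blast
    have "inf_on UNIV f < ereal (c - e)"
      using c(1) by (cases "inf_on UNIV f") auto
    then obtain d where d: "inf_on UNIV f < ereal d" "ereal d < ereal (c - e)"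
      using ereal_dense2 by blast
    have "p \<in> box c (c - d)" "0 < c - d"
      using p(1-3) c(2) d by (auto simp: box_def)
    then show "p \<in> (\<Union>c. \<Union>r\<in>{0<..}. box c r)" by blast
  qed
  finally show ?thesis .
qed

section \<open>Measurability of hitting a closed set\<close>

lemma exhaustion_by_compacts:
  assumes "locally_compact_space (euclidean :: 'a::second_countable_topology topology)"
  obtains \<C> :: "'a::second_countable_topology set set" where "countable \<C>" "\<And>C. C \<in> \<C> \<Longrightarrow> compact C" "\<Union>\<C> = UNIV"
proof -
  define \<U> where "\<U> = {U :: 'a set. open U \<and> (\<exists>C. compact C \<and> U \<subseteq> C)}"
  have "x \<in> \<Union>\<U>" for x
    using assms unfolding locally_compact_space_def \<U>_def by fastforce
  then have cover: "\<Union>\<U> = UNIV" by blast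
  have "openin (top_of_set UNIV) U" if "U \<in> \<U>" for U
    using that by (simp add: \<U>_def)
  then obtain \<V> where \<V>: "\<V> \<subseteq> \<U>" "countable \<V>" "\<Union>\<V> = UNIV"
    using cover by (metis Lindelof_openin)
  have "\<forall>V\<in>\<V>. \<exists>C. compact C \<and> V \<subseteq> C" using \<V>(1) by (auto simp: \<U>_def)
  then obtain h where "\<forall>V\<in>\<V>. compact (h V) \<and> V \<subseteq> h V" by metis
  moreover from this have "\<Union>(h ` \<V>) = UNIV" using \<V>(3) by blast
  ultimately show ?thesis using \<V>(2) by (intro that[of "h ` \<V>"]) auto
qed

lemma openin_sets_borel_of: "openin X U \<Longrightarrow> U \<in> sets (borel_of X)"
  unfolding borel_of_def using openin_subset
  by (subst sets_measure_of) (auto intro: sigma_sets.Basic)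

context
  fixes N :: "'v measure" and Z :: "'v \<Rightarrow> 'a::topological_space \<Rightarrow> ereal"
    and \<epsilon> :: "'v \<Rightarrow> real"
  assumes meas: "(\<lambda>\<omega>. (Z \<omega>, \<epsilon> \<omega>)) \<in>
    N \<rightarrow>\<^sub>M borel_of (prod_topology epi_topology left_order_topology)"
begin

lemma avoiding_iff_disjoint:
  assumes "\<omega> \<in> space N"
  shows "(Z \<omega>, \<epsilon> \<omega>) \<in> approx_argmin_avoiding K \<longleftrightarrow> approx_argmin (Z \<omega>) (\<epsilon> \<omega>) \<inter> K = {}"
proof -
  have "(Z \<omega>, \<epsilon> \<omega>) \<in> lsc_functions \<times> {0..}"
    using measurable_space[OF meas assms] by (simp add: borel_of_def space_measure_of_conv)
  then show ?thesis by (simp add: approx_argmin_avoiding_def)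
qed

lemma hitting_compact_measurable:
  assumes "compact K"
  shows "{\<omega> \<in> space N. approx_argmin (Z \<omega>) (\<epsilon> \<omega>) \<inter> K \<noteq> {}} \<in> sets N"
proof -
  have "approx_argmin_avoiding K \<in>
      sets (borel_of (prod_topology epi_topology left_order_topology))"
    by (rule openin_sets_borel_of[OF openin_approx_argmin_avoiding[OF assms]])
  then have "(\<lambda>\<omega>. (Z \<omega>, \<epsilon> \<omega>)) -` approx_argmin_avoiding K \<inter> space N \<in> sets N"
    by (rule measurable_sets[OF meas])
  then have "space N - ((\<lambda>\<omega>. (Z \<omega>, \<epsilon> \<omega>)) -` approx_argmin_avoiding K \<inter> space N) \<in> sets N"
    by (rule sets.compl_sets)
  also have "space N - ((\<lambda>\<omega>. (Z \<omega>, \<epsilon> \<omega>)) -` approx_argmin_avoiding K \<inter> space N) =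
      {\<omega> \<in> space N. approx_argmin (Z \<omega>) (\<epsilon> \<omega>) \<inter> K \<noteq> {}}"
    using avoiding_iff_disjoint by auto
  finally show ?thesis .
qed

end

text \<open>
  Epi-topological openness is available for compact sets only, but \<open>F\<close> is a countable union of
  compact sets. Without measurability the measure of the event would be the default value \<open>0\<close>
  and the capacity functional would carry no information at \<open>F\<close>.
\<close>

lemma hitting_closed_measurable:
  fixes Z :: "'v \<Rightarrow> 'a::second_countable_topology \<Rightarrow> ereal"
  assumes meas: "(\<lambda>\<omega>. (Z \<omega>, \<epsilon> \<omega>)) \<in>
      N \<rightarrow>\<^sub>M borel_of (prod_topology epi_topology left_order_topology)"
    and lc: "locally_compact_space (euclidean :: 'a topology)" and F: "closed F"
  shows "{\<omega> \<in> space N. approx_argmin (Z \<omega>) (\<epsilon> \<omega>) \<inter> F \<noteq> {}} \<in> sets N"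
proof -
  obtain \<C> :: "'a set set"
    where \<C>: "countable \<C>" "\<And>C. C \<in> \<C> \<Longrightarrow> compact C" "\<Union>\<C> = UNIV"
    using exhaustion_by_compacts[OF lc] by blast
  have "{\<omega> \<in> space N. approx_argmin (Z \<omega>) (\<epsilon> \<omega>) \<inter> F \<noteq> {}} =
      (\<Union>C\<in>\<C>. {\<omega> \<in> space N. approx_argmin (Z \<omega>) (\<epsilon> \<omega>) \<inter> (C \<inter> F) \<noteq> {}})"
    using \<C>(3) by blast
  also have "\<dots> \<in> sets N"
  proof (rule sets.countable_UN'[OF \<C>(1)], rule image_subsetI)
    fix C assume "C \<in> \<C>"
    then show "{\<omega> \<in> space N. approx_argmin (Z \<omega>) (\<epsilon> \<omega>) \<inter> (C \<inter> F) \<noteq> {}} \<in> sets N"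
      by (intro hitting_compact_measurable[OF meas] compact_Int_closed \<C>(2) F)
  qed
  finally show ?thesis .
qed

section \<open>Limits of probabilities\<close>

lemma le_Liminf_ereal_iff:
  "ereal c \<le> Liminf F (\<lambda>x. ereal (p x)) \<longleftrightarrow> (\<forall>\<eta>>0. eventually (\<lambda>x. c - \<eta> < p x) F)"
  unfolding le_Liminf_iff
proof (intro iffI allI impI)
  fix \<eta> :: real assume *: "\<forall>y<ereal c. eventually (\<lambda>x. y < ereal (p x)) F" and "0 < \<eta>"
  then show "eventually (\<lambda>x. c - \<eta> < p x) F" using *[rule_format, of "ereal (c - \<eta>)"] by simp
next
  fix y assume *: "\<forall>\<eta>>0. eventually (\<lambda>x. c - \<eta> < p x) F" and "y < ereal c"
  then show "eventually (\<lambda>x. y < ereal (p x)) F"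
    using *[rule_format, of "c - real_of_ereal y"] by (cases y) auto
qed

lemma Limsup_ereal_le_iff:
  "Limsup F (\<lambda>x. ereal (p x)) \<le> ereal c \<longleftrightarrow> (\<forall>\<eta>>0. eventually (\<lambda>x. p x < c + \<eta>) F)"
proof -
  have "Limsup F (\<lambda>x. ereal (p x)) = - Liminf F (\<lambda>x. ereal (- p x))"
    using ereal_Limsup_uminus[of F "\<lambda>x. ereal (- p x)"] by simp
  moreover have "- Liminf F (\<lambda>x. ereal (- p x)) \<le> ereal c \<longleftrightarrow>
      ereal (- c) \<le> Liminf F (\<lambda>x. ereal (- p x))"
    by (metis ereal_minus_le_minus ereal_uminus_uminus uminus_ereal.simps(1))
  moreover have "- c - \<eta> < - p x \<longleftrightarrow> p x < c + \<eta>" for \<eta> x by linarith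
  ultimately show ?thesis unfolding le_Liminf_ereal_iff by simp
qed

lemma le_Liminf_iff_Limsup_complement:
  assumes "eventually (\<lambda>x. p x + q x = (1::real)) F"
  shows "ereal (1 - c) \<le> Liminf F (\<lambda>x. ereal (p x)) \<longleftrightarrow> Limsup F (\<lambda>x. ereal (q x)) \<le> ereal c"
proof -
  have "eventually (\<lambda>x. 1 - c - \<eta> < p x) F \<longleftrightarrow> eventually (\<lambda>x. q x < c + \<eta>) F" for \<eta>
    by (rule eventually_cong[OF assms]) auto
  then show ?thesis unfolding le_Liminf_ereal_iff Limsup_ereal_le_iff by simp
qed

lemma (in prob_space) prob_add_complement:
  assumes "X \<in> M \<rightarrow>\<^sub>M A" "B \<in> sets A"
  shows "\<P>(\<omega> in M. X \<omega> \<in> B) + \<P>(\<omega> in M. X \<omega> \<notin> B) = 1"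
proof -
  have "{\<omega> \<in> space M. X \<omega> \<in> B} \<in> events"
    using measurable_sets[OF assms] by (simp add: vimage_def Collect_conj_eq Int_commute)
  then show ?thesis using prob_neg by simp
qed

lemma eventually_tails_mem:
  assumes "directed_preorder I le"
  shows "eventually (\<lambda>\<alpha>. \<alpha> \<in> I) (tails I le)"
  using assms unfolding eventually_tails[OF assms] directed_preorder_def by blast

text \<open>
  Closed sets have no mass bound of their own here; they inherit it from their compact subsets
  because only \<open>\<eta>\<close> of the mass can escape from a suitable compact \<open>K\<close> in the limit.
\<close>

lemma Limsup_prob_closed_le_if_tight:
  fixes \<xi> :: "'i \<Rightarrow> 'w \<Rightarrow> 'a::{second_countable_topology, t2_space}"
  assumes ev: "eventually (\<lambda>\<alpha>. prob_space (M \<alpha>) \<and> \<xi> \<alpha> \<in> M \<alpha> \<rightarrow>\<^sub>M borel) A"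
    and tight: "\<And>\<eta>::real. \<eta> > 0 \<Longrightarrow>
      \<exists>K. compact K \<and> ereal (1 - \<eta>) \<le> Liminf A (\<lambda>\<alpha>. ereal \<P>(\<omega> in M \<alpha>. \<xi> \<alpha> \<omega> \<in> K))"
    and F: "closed F"
    and compact_bound: "\<And>K. compact K \<Longrightarrow> K \<subseteq> F \<Longrightarrow>
      Limsup A (\<lambda>\<alpha>. ereal \<P>(\<omega> in M \<alpha>. \<xi> \<alpha> \<omega> \<in> K)) \<le> ereal c"
  shows "Limsup A (\<lambda>\<alpha>. ereal \<P>(\<omega> in M \<alpha>. \<xi> \<alpha> \<omega> \<in> F)) \<le> ereal c"
  unfolding Limsup_ereal_le_iff
proof (intro allI impI)
  fix \<eta> :: real assume "0 < \<eta>"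
  \<comment> \<open>One third each for tightness, for its limes inferior and for the bound on \<open>F \<inter> K\<close>.\<close>
  define \<delta> where "\<delta> = \<eta> / 3"
  have \<delta>: "0 < \<delta>" using \<open>0 < \<eta>\<close> by (simp add: \<delta>_def)
  obtain K where K: "compact K"
      "ereal (1 - \<delta>) \<le> Liminf A (\<lambda>\<alpha>. ereal \<P>(\<omega> in M \<alpha>. \<xi> \<alpha> \<omega> \<in> K))"
    using tight[OF \<delta>] by blast
  have "eventually (\<lambda>\<alpha>. 1 - \<delta> - \<delta> < \<P>(\<omega> in M \<alpha>. \<xi> \<alpha> \<omega> \<in> K)) A"
    using K(2) \<delta> unfolding le_Liminf_ereal_iff by blast
  moreover have "eventually (\<lambda>\<alpha>. \<P>(\<omega> in M \<alpha>. \<xi> \<alpha> \<omega> \<in> F \<inter> K) < c + \<delta>) A"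
    using compact_bound[of "F \<inter> K"] closed_Int_compact[OF F K(1)] \<delta>
    unfolding Limsup_ereal_le_iff by blast
  ultimately show "eventually (\<lambda>\<alpha>. \<P>(\<omega> in M \<alpha>. \<xi> \<alpha> \<omega> \<in> F) < c + \<eta>) A"
    using ev
  proof eventually_elim
    case (elim \<alpha>)
    interpret prob_space "M \<alpha>" using elim(3) by blast
    have [measurable]: "\<xi> \<alpha> \<in> M \<alpha> \<rightarrow>\<^sub>M borel" using elim(3) by blast
    have [measurable]: "F \<in> sets borel" "K \<in> sets borel"
      using F compact_imp_closed[OF K(1)] by auto
    have "\<P>(\<omega> in M \<alpha>. \<xi> \<alpha> \<omega> \<in> F) \<le> prob ({\<omega> \<in> space (M \<alpha>). \<xi> \<alpha> \<omega> \<in> F \<inter> K} \<union>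
        {\<omega> \<in> space (M \<alpha>). \<xi> \<alpha> \<omega> \<notin> K})"
      by (rule finite_measure_mono) auto
    also have "\<dots> \<le> \<P>(\<omega> in M \<alpha>. \<xi> \<alpha> \<omega> \<in> F \<inter> K) + \<P>(\<omega> in M \<alpha>. \<xi> \<alpha> \<omega> \<notin> K)"
      by (rule measure_Un_le) auto
    finally show ?case
      using elim(1,2) prob_add_complement[of "\<xi> \<alpha>" borel K] unfolding \<delta>_def by simp
  qed
qed

section \<open>Convergence of approximate minimizers\<close>

text \<open>
  A selection that lies in \<open>K\<close> witnesses that its approximate argmin set meets \<open>K\<close>. The latter
  is the complement of an open condition on the pair, to which convergence in distribution
  applies.
\<close>

lemma Limsup_prob_selection_in_compact:
  fixes Z :: "'v \<Rightarrow> 'a::topological_space \<Rightarrow> ereal"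
  assumes dir: "directed_preorder I le"
    and M: "\<And>\<alpha>. \<alpha> \<in> I \<Longrightarrow> prob_space (M \<alpha>)" and N: "prob_space N"
    and sel: "\<And>\<alpha>. \<alpha> \<in> I \<Longrightarrow>
      measurable_selection (M \<alpha>) (\<lambda>\<omega>. approx_argmin (Z\<^sub>\<alpha> \<alpha> \<omega>) (\<epsilon>\<^sub>\<alpha> \<alpha> \<omega>)) (\<xi>\<^sub>\<alpha> \<alpha>)"
    and conv: "conv_in_distr (prod_topology epi_topology left_order_topology) I le
      M (\<lambda>\<alpha> \<omega>. (Z\<^sub>\<alpha> \<alpha> \<omega>, \<epsilon>\<^sub>\<alpha> \<alpha> \<omega>)) N (\<lambda>\<omega>. (Z \<omega>, \<epsilon> \<omega>))"
    and K: "compact K"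
  shows "Limsup (tails I le) (\<lambda>\<alpha>. ereal \<P>(\<omega> in M \<alpha>. \<xi>\<^sub>\<alpha> \<alpha> \<omega> \<in> K))
    \<le> ereal \<P>(\<omega> in N. approx_argmin (Z \<omega>) (\<epsilon> \<omega>) \<inter> K \<noteq> {})"
proof -
  let ?X = "prod_topology epi_topology left_order_topology :: (('a \<Rightarrow> ereal) \<times> real) topology"
  let ?U = "approx_argmin_avoiding K"
  let ?hit = "\<P>(\<omega> in N. approx_argmin (Z \<omega>) (\<epsilon> \<omega>) \<inter> K \<noteq> {})"
  have U: "openin ?X ?U" by (rule openin_approx_argmin_avoiding[OF K])
  note U_sets = openin_sets_borel_of[OF U]
  have meas: "(\<lambda>\<omega>. (Z\<^sub>\<alpha> \<alpha> \<omega>, \<epsilon>\<^sub>\<alpha> \<alpha> \<omega>)) \<in> M \<alpha> \<rightarrow>\<^sub>M borel_of ?X" if "\<alpha> \<in> I" for \<alpha>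
    using conv[unfolded conv_in_distr_def, THEN conjunct1] that by (rule bspec)
  have measN: "(\<lambda>\<omega>. (Z \<omega>, \<epsilon> \<omega>)) \<in> N \<rightarrow>\<^sub>M borel_of ?X"
    using conv[unfolded conv_in_distr_def, THEN conjunct2] by (rule conjunct1)
  have "{\<omega> \<in> space N. (Z \<omega>, \<epsilon> \<omega>) \<notin> ?U} =
      {\<omega> \<in> space N. approx_argmin (Z \<omega>) (\<epsilon> \<omega>) \<inter> K \<noteq> {}}"
    using avoiding_iff_disjoint[OF measN] by auto
  then have "\<P>(\<omega> in N. (Z \<omega>, \<epsilon> \<omega>) \<in> ?U) = 1 - ?hit"
    using prob_space.prob_add_complement[OF N measN U_sets] by simp
  then have lim: "ereal (1 - ?hit) \<le>
      Liminf (tails I le) (\<lambda>\<alpha>. ereal \<P>(\<omega> in M \<alpha>. (Z\<^sub>\<alpha> \<alpha> \<omega>, \<epsilon>\<^sub>\<alpha> \<alpha> \<omega>) \<in> ?U))"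
    using conv[unfolded conv_in_distr_def, THEN conjunct2, THEN conjunct2, rule_format, OF U]
    by simp
  have "eventually (\<lambda>\<alpha>. \<P>(\<omega> in M \<alpha>. (Z\<^sub>\<alpha> \<alpha> \<omega>, \<epsilon>\<^sub>\<alpha> \<alpha> \<omega>) \<in> ?U)
      + \<P>(\<omega> in M \<alpha>. (Z\<^sub>\<alpha> \<alpha> \<omega>, \<epsilon>\<^sub>\<alpha> \<alpha> \<omega>) \<notin> ?U) = 1) (tails I le)"
    using eventually_tails_mem[OF dir]
  proof eventually_elim
    case (elim \<alpha>)
    show ?case by (rule prob_space.prob_add_complement[OF M[OF elim] meas[OF elim] U_sets])
  qed
  with lim have "Limsup (tails I le)
      (\<lambda>\<alpha>. ereal \<P>(\<omega> in M \<alpha>. (Z\<^sub>\<alpha> \<alpha> \<omega>, \<epsilon>\<^sub>\<alpha> \<alpha> \<omega>) \<notin> ?U)) \<le> ereal ?hit"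
    by (simp add: le_Liminf_iff_Limsup_complement)
  moreover have "Limsup (tails I le) (\<lambda>\<alpha>. ereal \<P>(\<omega> in M \<alpha>. \<xi>\<^sub>\<alpha> \<alpha> \<omega> \<in> K)) \<le>
      Limsup (tails I le) (\<lambda>\<alpha>. ereal \<P>(\<omega> in M \<alpha>. (Z\<^sub>\<alpha> \<alpha> \<omega>, \<epsilon>\<^sub>\<alpha> \<alpha> \<omega>) \<notin> ?U))"
  proof (rule Limsup_mono, rule eventually_mono[OF eventually_tails_mem[OF dir]])
    fix \<alpha> assume \<alpha>: "\<alpha> \<in> I"
    interpret prob_space "M \<alpha>" by (rule M[OF \<alpha>])
    have "AE \<omega> in M \<alpha>. \<xi>\<^sub>\<alpha> \<alpha> \<omega> \<in> approx_argmin (Z\<^sub>\<alpha> \<alpha> \<omega>) (\<epsilon>\<^sub>\<alpha> \<alpha> \<omega>)"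
      using sel[OF \<alpha>] by (simp add: measurable_selection_def)
    then have "AE \<omega> in M \<alpha>. \<omega> \<in> {\<omega> \<in> space (M \<alpha>). \<xi>\<^sub>\<alpha> \<alpha> \<omega> \<in> K} \<longrightarrow>
        \<omega> \<in> {\<omega> \<in> space (M \<alpha>). (Z\<^sub>\<alpha> \<alpha> \<omega>, \<epsilon>\<^sub>\<alpha> \<alpha> \<omega>) \<notin> ?U}"
      by eventually_elim (auto simp: approx_argmin_avoiding_def)
    moreover have "{\<omega> \<in> space (M \<alpha>). (Z\<^sub>\<alpha> \<alpha> \<omega>, \<epsilon>\<^sub>\<alpha> \<alpha> \<omega>) \<notin> ?U} =
        {\<omega> \<in> space (M \<alpha>). approx_argmin (Z\<^sub>\<alpha> \<alpha> \<omega>) (\<epsilon>\<^sub>\<alpha> \<alpha> \<omega>) \<inter> K \<noteq> {}}"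
      using avoiding_iff_disjoint[OF meas[OF \<alpha>]] by auto
    then have "{\<omega> \<in> space (M \<alpha>). (Z\<^sub>\<alpha> \<alpha> \<omega>, \<epsilon>\<^sub>\<alpha> \<alpha> \<omega>) \<notin> ?U} \<in> sets (M \<alpha>)"
      using hitting_compact_measurable[OF meas[OF \<alpha>] K] by (rule ssubst)
    ultimately show "ereal \<P>(\<omega> in M \<alpha>. \<xi>\<^sub>\<alpha> \<alpha> \<omega> \<in> K) \<le>
        ereal \<P>(\<omega> in M \<alpha>. (Z\<^sub>\<alpha> \<alpha> \<omega>, \<epsilon>\<^sub>\<alpha> \<alpha> \<omega>) \<notin> ?U)"
      unfolding ereal_less_eq by (rule finite_measure_mono_AE)
  qed
  ultimately show ?thesis by (rule order_trans[rotated])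
qed

theorem theorem7:
  fixes I :: "'i set" and le :: "'i \<Rightarrow> 'i \<Rightarrow> bool"
    and M :: "'i \<Rightarrow> 'w measure" and N :: "'v measure"
    and Z\<^sub>\<alpha> :: "'i \<Rightarrow> 'w \<Rightarrow> 'a::{second_countable_topology, t2_space} \<Rightarrow> ereal"
    and \<epsilon>\<^sub>\<alpha> :: "'i \<Rightarrow> 'w \<Rightarrow> real" and \<xi>\<^sub>\<alpha> :: "'i \<Rightarrow> 'w \<Rightarrow> 'a"
    and Z :: "'v \<Rightarrow> 'a \<Rightarrow> ereal" and \<epsilon> :: "'v \<Rightarrow> real"
  assumes "locally_compact_space (euclidean :: 'a topology)"
    and "directed_preorder I le"
    and "\<And>\<alpha>. \<alpha> \<in> I \<Longrightarrow> prob_space (M \<alpha>)"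
    and "\<And>\<alpha>. \<alpha> \<in> I \<Longrightarrow> normal_integrand (M \<alpha>) (Z\<^sub>\<alpha> \<alpha>)"
    and "\<And>\<alpha>. \<alpha> \<in> I \<Longrightarrow> \<epsilon>\<^sub>\<alpha> \<alpha> \<in> borel_measurable (M \<alpha>)"
    and "\<And>\<alpha> \<omega>. \<alpha> \<in> I \<Longrightarrow> \<omega> \<in> space (M \<alpha>) \<Longrightarrow> 0 \<le> \<epsilon>\<^sub>\<alpha> \<alpha> \<omega>"
    and "prob_space N"
    and "normal_integrand N Z"
    and "\<epsilon> \<in> borel_measurable N"
    and "\<And>\<omega>. \<omega> \<in> space N \<Longrightarrow> 0 \<le> \<epsilon> \<omega>"
    and "\<And>\<alpha>. \<alpha> \<in> I \<Longrightarrow>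
           measurable_selection (M \<alpha>) (\<lambda>\<omega>. approx_argmin (Z\<^sub>\<alpha> \<alpha> \<omega>) (\<epsilon>\<^sub>\<alpha> \<alpha> \<omega>)) (\<xi>\<^sub>\<alpha> \<alpha>)"
    and "conv_in_distr (prod_topology epi_topology left_order_topology) I le
           M (\<lambda>\<alpha> \<omega>. (Z\<^sub>\<alpha> \<alpha> \<omega>, \<epsilon>\<^sub>\<alpha> \<alpha> \<omega>)) N (\<lambda>\<omega>. (Z \<omega>, \<epsilon> \<omega>))"
    and "\<And>\<eta>::real. \<eta> > 0 \<Longrightarrow>
           \<exists>K. compact K \<and> ereal (1 - \<eta>) \<le> Liminf (tails I le) (\<lambda>\<alpha>. ereal \<P>(\<omega> in M \<alpha>. \<xi>\<^sub>\<alpha> \<alpha> \<omega> \<in> K))"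
  shows "(\<forall>F. closed F \<longrightarrow>
            Limsup (tails I le) (\<lambda>\<alpha>. ereal \<P>(\<omega> in M \<alpha>. \<xi>\<^sub>\<alpha> \<alpha> \<omega> \<in> F))
              \<le> ereal (capacity_functional N (\<lambda>\<omega>. approx_argmin (Z \<omega>) (\<epsilon> \<omega>)) F)) \<and>
         (\<forall>\<xi> \<in> borel_measurable N.
            (AE \<omega> in N. \<epsilon> \<omega> = 0) \<longrightarrow> (AE \<omega> in N. Argmin (Z \<omega>) \<subseteq> {\<xi> \<omega>}) \<longrightarrow>
            conv_in_distr euclidean I le M \<xi>\<^sub>\<alpha> N \<xi>)"
proof -
  note lc = assms(1) and dir = assms(2) and M = assms(3) and N = assms(7)
    and sel = assms(11) and conv = assms(12) and tight = assms(13)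
  interpret N: prob_space N by (rule N)
  have \<xi>\<^sub>\<alpha>_meas: "\<xi>\<^sub>\<alpha> \<alpha> \<in> M \<alpha> \<rightarrow>\<^sub>M borel" if "\<alpha> \<in> I" for \<alpha>
    using sel[OF that] by (simp add: measurable_selection_def)
  have measN: "(\<lambda>\<omega>. (Z \<omega>, \<epsilon> \<omega>)) \<in>
      N \<rightarrow>\<^sub>M borel_of (prod_topology epi_topology left_order_topology)"
    using conv[unfolded conv_in_distr_def, THEN conjunct2] by (rule conjunct1)
  have hit: "{\<omega> \<in> space N. approx_argmin (Z \<omega>) (\<epsilon> \<omega>) \<inter> F \<noteq> {}} \<in> sets N"
    if "closed F" for F by (rule hitting_closed_measurable[OF measN lc that])
  have capacity: "capacity_functional N (\<lambda>\<omega>. approx_argmin (Z \<omega>) (\<epsilon> \<omega>)) F =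
      \<P>(\<omega> in N. approx_argmin (Z \<omega>) (\<epsilon> \<omega>) \<inter> F \<noteq> {})" if "closed F" for F
    using measure_completion[OF hit[OF that]] by (simp add: capacity_functional_def)
  have closed_bound: "Limsup (tails I le) (\<lambda>\<alpha>. ereal \<P>(\<omega> in M \<alpha>. \<xi>\<^sub>\<alpha> \<alpha> \<omega> \<in> F))
      \<le> ereal \<P>(\<omega> in N. approx_argmin (Z \<omega>) (\<epsilon> \<omega>) \<inter> F \<noteq> {})" if F: "closed F" for F
  proof (rule Limsup_prob_closed_le_if_tight[OF _ tight F])
    show "eventually (\<lambda>\<alpha>. prob_space (M \<alpha>) \<and> \<xi>\<^sub>\<alpha> \<alpha> \<in> M \<alpha> \<rightarrow>\<^sub>M borel) (tails I le)"
      using eventually_tails_mem[OF dir] by eventually_elim (use M \<xi>\<^sub>\<alpha>_meas in blast)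
    fix K assume K: "compact K" "K \<subseteq> F"
    have "\<P>(\<omega> in N. approx_argmin (Z \<omega>) (\<epsilon> \<omega>) \<inter> K \<noteq> {}) \<le>
        \<P>(\<omega> in N. approx_argmin (Z \<omega>) (\<epsilon> \<omega>) \<inter> F \<noteq> {})"
      using K(2) hit[OF F] by (intro N.finite_measure_mono) auto
    then show "Limsup (tails I le) (\<lambda>\<alpha>. ereal \<P>(\<omega> in M \<alpha>. \<xi>\<^sub>\<alpha> \<alpha> \<omega> \<in> K)) \<le>
        ereal \<P>(\<omega> in N. approx_argmin (Z \<omega>) (\<epsilon> \<omega>) \<inter> F \<noteq> {})"
      using order_trans[OF Limsup_prob_selection_in_compact[OF dir M N sel conv K(1)]] by simp
  qed
  have "conv_in_distr euclidean I le M \<xi>\<^sub>\<alpha> N \<xi>"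
    if \<xi>: "\<xi> \<in> borel_measurable N" and zero: "AE \<omega> in N. \<epsilon> \<omega> = 0"
      and unique: "AE \<omega> in N. Argmin (Z \<omega>) \<subseteq> {\<xi> \<omega>}" for \<xi>
    unfolding conv_in_distr_def measurable_cong_sets[OF refl sets_borel_of_euclidean]
  proof (intro conjI ballI allI impI)
    fix U :: "'a set" assume "openin euclidean U"
    then have U: "open U" by simp
    note U_sets = borel_open[OF U]
    have "AE \<omega> in N. \<omega> \<in> {\<omega> \<in> space N. approx_argmin (Z \<omega>) (\<epsilon> \<omega>) \<inter> - U \<noteq> {}} \<longrightarrow>
        \<omega> \<in> {\<omega> \<in> space N. \<xi> \<omega> \<notin> U}"
      using zero unique by eventually_elim (auto simp: Argmin_def)
    moreover have "{\<omega> \<in> space N. \<xi> \<omega> \<notin> U} \<in> sets N"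
      using \<xi> U_sets by measurable
    ultimately have "\<P>(\<omega> in N. approx_argmin (Z \<omega>) (\<epsilon> \<omega>) \<inter> - U \<noteq> {}) \<le> \<P>(\<omega> in N. \<xi> \<omega> \<notin> U)"
      by (rule N.finite_measure_mono_AE)
    then have "Limsup (tails I le) (\<lambda>\<alpha>. ereal \<P>(\<omega> in M \<alpha>. \<xi>\<^sub>\<alpha> \<alpha> \<omega> \<notin> U))
        \<le> ereal \<P>(\<omega> in N. \<xi> \<omega> \<notin> U)"
      using order_trans[OF closed_bound[OF closed_Compl[OF U]]] by simp
    moreover have "eventually (\<lambda>\<alpha>. \<P>(\<omega> in M \<alpha>. \<xi>\<^sub>\<alpha> \<alpha> \<omega> \<in> U)
        + \<P>(\<omega> in M \<alpha>. \<xi>\<^sub>\<alpha> \<alpha> \<omega> \<notin> U) = 1) (tails I le)"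
      using eventually_tails_mem[OF dir]
    proof eventually_elim
      case (elim \<alpha>)
      show ?case by (rule prob_space.prob_add_complement[OF M[OF elim] \<xi>\<^sub>\<alpha>_meas[OF elim] U_sets])
    qed
    ultimately have "ereal (1 - \<P>(\<omega> in N. \<xi> \<omega> \<notin> U)) \<le>
        Liminf (tails I le) (\<lambda>\<alpha>. ereal \<P>(\<omega> in M \<alpha>. \<xi>\<^sub>\<alpha> \<alpha> \<omega> \<in> U))"
      by (simp add: le_Liminf_iff_Limsup_complement)
    moreover have "1 - \<P>(\<omega> in N. \<xi> \<omega> \<notin> U) = \<P>(\<omega> in N. \<xi> \<omega> \<in> U)"
      using N.prob_add_complement[OF \<xi> U_sets] by simp
    ultimately show "ereal \<P>(\<omega> in N. \<xi> \<omega> \<in> U) \<le>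
        Liminf (tails I le) (\<lambda>\<alpha>. ereal \<P>(\<omega> in M \<alpha>. \<xi>\<^sub>\<alpha> \<alpha> \<omega> \<in> U))"
      by simp
  qed (use \<xi> \<xi>\<^sub>\<alpha>_meas in auto)
  then show ?thesis using closed_bound capacity by simp
qed

end
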